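(* The direct product of two tunable Kripke frames is not in general tunable: if $A$ is a countably infinite set, $\Delta_A=\{(a,a)\mid a\in A\}$, and $(\omega,\leq)$ is the set of natural numbers with its standard ordering, then $(A,\Delta_A)$ and $(\omega,\leq)$ are both tunable, but their direct product is not tunable.
   Context: A Kripke frame $(X,R)$ is a set $X$ with a binary relation $R$. The direct product of $(X,R)$ and $(Y,S)$ is the frame on $X\times Y$ in which $(x,y)$ is related to $(x',y')$ iff $xRx'$ and $ySy'$. A partition $P$ of $X$ is $R$-tuned if for all $A,B\in P$: if $aRb$ for some $a\in A$, $b\in B$, then for every $a\in A$ there is $b\in B$ with $aRb$. A partition $Q$ refines $P$ if each element of $P$ is a union of elements of $Q$. A Kripke frame $(X,R)$ is tunable if every finite partition of $X$ has a finite $R$-tuned refinement. *)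

theory Defs
  imports "HOL-Library.Disjoint_Sets" "HOL-Library.Countable_Set"
begin

type_synonym 'a frame = "'a set \<times> 'a rel"

definition kripke_frame :: "'a frame \<Rightarrow> bool" where
  "kripke_frame = (\<lambda>(X, R). R \<subseteq> X \<times> X)"

definition frame_prod :: "'a frame \<Rightarrow> 'b frame \<Rightarrow> ('a \<times> 'b) frame" where
  "frame_prod = (\<lambda>(X, R) (Y, S).
     (X \<times> Y, {((x, y), (x', y')). (x, x') \<in> R \<and> (y, y') \<in> S}))"

definition tuned :: "'a rel \<Rightarrow> 'a set set \<Rightarrow> bool" where
  "tuned R P \<longleftrightarrow> (\<forall>A\<in>P. \<forall>B\<in>P.
     (\<exists>a\<in>A. \<exists>b\<in>B. (a, b) \<in> R) \<longrightarrow> (\<forall>a\<in>A. \<exists>b\<in>B. (a, b) \<in> R))"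

definition tunable :: "'a frame \<Rightarrow> bool" where
  "tunable = (\<lambda>(X, R). \<forall>P. partition_on X P \<and> finite P \<longrightarrow>
     (\<exists>Q. refines X Q P \<and> finite Q \<and> tuned R Q))"

(* The library's refinement (finer partition first) asks each block of Q to lie in a block of P.
   For partitions this is the same as each block of P being a union of blocks of Q. *)
lemma refines_iff_union:
  "refines X Q P \<longleftrightarrow>
     partition_on X Q \<and> partition_on X P \<and> (\<forall>A\<in>P. \<exists>\<B>\<subseteq>Q. A = \<Union>\<B>)"
proof (intro iffI conjI ballI)
  assume ref: "refines X Q P"
  then show Q: "partition_on X Q" and P: "partition_on X P"
    by (simp_all add: refines_def)
  have UQ: "\<Union>Q = X" and UP: "\<Union>P = X" and dP: "disjoint P"
    using P Q by (simp_all add: partition_on_def)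
  fix A assume A: "A \<in> P"
  have "\<exists>B\<in>Q. x \<in> B \<and> B \<subseteq> A" if x: "x \<in> A" for x
  proof -
    have "x \<in> \<Union>Q" using x A UP UQ by blast
    then obtain B where B: "B \<in> Q" "x \<in> B" by blast
    then obtain A' where A': "A' \<in> P" "B \<subseteq> A'"
      using ref unfolding refines_def by blast
    have "A' = A"
      using disjointD[OF dP A'(1) A] A'(2) B(2) x by blast
    then show ?thesis using A'(2) B by blast
  qed
  then have "A = \<Union>{B \<in> Q. B \<subseteq> A}" by blast
  moreover have "{B \<in> Q. B \<subseteq> A} \<subseteq> Q" by blast
  ultimately show "\<exists>\<B>\<subseteq>Q. A = \<Union>\<B>" by blast
next
  assume asm: "partition_on X Q \<and> partition_on X P \<and> (\<forall>A\<in>P. \<exists>\<B>\<subseteq>Q. A = \<Union>\<B>)"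
  then have UQ: "\<Union>Q = X" and UP: "\<Union>P = X" and dQ: "disjoint Q" and nQ: "{} \<notin> Q"
    by (simp_all add: partition_on_def)
  have "\<exists>A\<in>P. B \<subseteq> A" if B: "B \<in> Q" for B
  proof -
    have "B \<noteq> {}" using B nQ by blast
    then obtain x where x: "x \<in> B" by blast
    then have "x \<in> \<Union>P" using B UP UQ by blast
    then obtain A where A: "A \<in> P" "x \<in> A" by blast
    then obtain \<B> where \<B>: "\<B> \<subseteq> Q" "A = \<Union>\<B>" using asm by blast
    then obtain B' where B': "B' \<in> \<B>" "x \<in> B'" using A(2) by blast
    have "B' \<in> Q" using \<B>(1) B'(1) by blast
    then have "B' = B"
      using disjointD[OF dQ _ B] B'(2) x by blast
    then show ?thesis using A(1) \<B>(2) B'(1) by blast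
  qed
  then show "refines X Q P" using asm by (simp add: refines_def)
qed

lemma kripke_frame_Id_on: "kripke_frame (A, Id_on A)"
  by (auto simp: kripke_frame_def)

lemma kripke_frame_UNIV: "kripke_frame (UNIV, R)"
  by (simp add: kripke_frame_def)

lemma kripke_frame_prod:
  "kripke_frame F \<Longrightarrow> kripke_frame G \<Longrightarrow> kripke_frame (frame_prod F G)"
  by (auto simp: kripke_frame_def frame_prod_def)

end

(* In the product, color the point (a, n) by whether n is even and n \<le> 2 * e a, where e maps A
   onto the natural numbers. Along the column of a the color switches finitely often, and the number
   of switches still ahead of a point is invariant under any tuned refinement of the coloring.
   This number is unbounded over the points (a, 0), so such a refinement has infinitely many blocks.
   For the natural numbers alone, a finite partition becomes tuned once all points below some N are
   split off, where N bounds all finite blocks: every remaining block is then cofinal. *)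
theory Submission
  imports Defs
begin

text \<open>A point sees only itself, so disjoint blocks can be related only when they coincide, and
  then each point is its own witness.\<close>

lemma tuned_Id_on:
  assumes "disjoint P" and X: "\<Union>P \<subseteq> X"
  shows "tuned (Id_on X) P"
  unfolding tuned_def
proof (intro ballI impI)
  fix A B a
  assume A: "A \<in> P" and B: "B \<in> P" and a: "a \<in> A"
    and "\<exists>a\<in>A. \<exists>b\<in>B. (a, b) \<in> Id_on X"
  then have "A \<inter> B \<noteq> {}" by auto
  then have "A = B" using disjointD[OF assms(1) A B] by blast
  then show "\<exists>b\<in>B. (a, b) \<in> Id_on X" using a X A by blast
qed

lemma tunable_Id_on: "tunable (X, Id_on X)"
  unfolding tunable_def
proof (clarsimp)
  fix P assume P: "partition_on X P" "finite P"
  then have "refines X P P" "tuned (Id_on X) P"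
    by (auto simp: refines_def partition_on_def intro: tuned_Id_on)
  then show "\<exists>Q. refines X Q P \<and> finite Q \<and> tuned (Id_on X) Q"
    using P by blast
qed

lemma finite_blocks_bounded:
  fixes P :: "nat set set"
  assumes "finite P"
  obtains N where "\<And>B n. B \<in> P \<Longrightarrow> finite B \<Longrightarrow> n \<in> B \<Longrightarrow> n < N"
proof -
  have "finite (\<Union>{B \<in> P. finite B})" using assms by auto
  then obtain N where "\<forall>n\<in>\<Union>{B \<in> P. finite B}. n < N"
    using finite_nat_set_iff_bounded by blast
  then show thesis using that by blast
qed

lemma tunable_nat_le: "tunable (UNIV :: nat set, {(m, n). m \<le> n})"
  unfolding tunable_def
proof (clarsimp)
  fix P :: "nat set set"
  assume P: "partition_on UNIV P" "finite P"
  obtain N where N: "\<And>B n. B \<in> P \<Longrightarrow> finite B \<Longrightarrow> n \<in> B \<Longrightarrow> n < N"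
    using finite_blocks_bounded[OF P(2)] by blast
  \<comment> \<open>Blocks of \<open>P\<close> lying entirely below \<open>N\<close>, among them all
    finite ones, leave an empty tail, which has to be discarded.\<close>
  define Q where "Q = (\<lambda>n. {n}) ` {..<N} \<union> ((\<lambda>B. B \<inter> {N..}) ` P - {{}})"
  have dP: "B = C" if "B \<in> P" "C \<in> P" "n \<in> B" "n \<in> C" for B C n
    using disjointD[OF partition_onD2[OF P(1)] that(1,2)] that(3,4) by blast
  have UP: "\<exists>B\<in>P. n \<in> B" for n
    using P(1) unfolding partition_on_def by blast
  have single: "{n} \<in> Q" if "n < N" for n
    using that by (simp add: Q_def)
  have tail: "B \<inter> {N..} \<in> Q" if "B \<in> P" "n \<in> B" "N \<le> n" for B n
  proof -
    have "B \<inter> {N..} \<noteq> {}" using that by auto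
    then show ?thesis using that(1) by (simp add: Q_def)
  qed
  have QE: thesis
    if "B \<in> Q" "\<And>n. B = {n} \<Longrightarrow> n < N \<Longrightarrow> thesis"
      "\<And>C. C \<in> P \<Longrightarrow> B = C \<inter> {N..} \<Longrightarrow> B \<noteq> {} \<Longrightarrow> thesis" for B thesis
    using that by (auto simp: Q_def)
  have "n \<in> \<Union>Q" for n
  proof (cases "n < N")
    case True
    then show ?thesis using single by (intro UnionI[of "{n}"]) simp_all
  next
    case False
    obtain B where "B \<in> P" "n \<in> B" using UP by blast
    then show ?thesis using False tail by (intro UnionI[of "B \<inter> {N..}"]) simp_all
  qed
  then have "\<Union>Q = UNIV" by blast
  moreover have "B = C" if "B \<in> Q" "C \<in> Q" "n \<in> B" "n \<in> C" for B C n
  proof (rule QE[OF that(1)]; rule QE[OF that(2)])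
    fix B' C' assume "B' \<in> P" "B = B' \<inter> {N..}" "C' \<in> P" "C = C' \<inter> {N..}"
    then show ?thesis using dP[of B' C' n] that(3,4) by simp
  qed (use that(3,4) in simp_all)
  then have "disjoint Q" by (meson disjointI disjoint_iff)
  moreover have "{} \<notin> Q"
    by (auto elim: QE)
  moreover have "\<exists>C\<in>P. B \<subseteq> C" if "B \<in> Q" for B
    using that
  proof (rule QE)
    fix n assume "B = {n}"
    then show ?thesis using UP[of n] by simp
  qed blast
  ultimately have "refines UNIV Q P"
    using P(1) by (simp add: refines_def partition_on_def)
  moreover have "finite Q"
    using P(2) by (simp add: Q_def)
  moreover have "tuned {(m, n). m \<le> n} Q"
    unfolding tuned_def
  proof (intro ballI impI)
    fix B C a
    assume B: "B \<in> Q" and C: "C \<in> Q" and a: "a \<in> B"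
      and "\<exists>b\<in>B. \<exists>c\<in>C. (b, c) \<in> {(m, n). m \<le> n}"
    then obtain b c where bc: "b \<in> B" "c \<in> C" "b \<le> c" by blast
    from C have "\<exists>c\<in>C. a \<le> c"
    proof (rule QE)
      \<comment> \<open>Here \<open>b \<le> k < N\<close>, so the block of \<open>b\<close> is a
        singleton as well and \<open>a = b\<close>.\<close>
      fix k assume k: "C = {k}" "k < N"
      from B have "a \<le> k"
        by (rule QE) (use a bc k in auto)
      then show ?thesis using k by simp
    next
      fix D assume D: "D \<in> P" "C = D \<inter> {N..}" "C \<noteq> {}"
      \<comment> \<open>The point \<open>c\<close> of \<open>D\<close> is at least \<open>N\<close>,
        whereas finite blocks stay below \<open>N\<close>.\<close>
      then have "infinite D" using N[of D c] bc(2) by auto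
      then obtain m where "m \<in> D" "max a N \<le> m"
        unfolding infinite_nat_iff_unbounded_le by blast
      then show ?thesis using D by (intro bexI[of _ m]) simp_all
    qed
    then show "\<exists>c\<in>C. (a, c) \<in> {(m, n). m \<le> n}" by simp
  qed
  ultimately show "\<exists>Q. refines UNIV Q P \<and> finite Q \<and> tuned {(m, n). m \<le> n} Q"
    by blast
qed

lemma not_tunable_prod:
  fixes X :: "'a set" and e :: "'a \<Rightarrow> nat"
  assumes e: "e ` X = UNIV"
  shows "\<not> tunable (frame_prod (X, Id_on X) (UNIV :: nat set, {(m, n). m \<le> n}))"
proof
  define R :: "('a \<times> nat) rel" where
    "R = {((x, m), (y, n)). (x, y) \<in> Id_on X \<and> m \<le> n}"
  \<comment> \<open>Column \<open>x\<close> starts in \<open>U\<close>, alternates up to height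
    \<open>2 * e x\<close>, where it is in \<open>U\<close> for the last time, and then stays in
    \<open>V\<close>. From \<open>(x, m)\<close> in \<open>U\<close> there remain
    \<open>2 * e x - m + 1\<close> switches.\<close>
  define U where "U = {(x, n). x \<in> X \<and> even n \<and> n \<le> 2 * e x}"
  define V where "V = X \<times> UNIV - U"
  assume "tunable (frame_prod (X, Id_on X) (UNIV :: nat set, {(m, n). m \<le> n}))"
  then have tun: "\<exists>Q. refines (X \<times> UNIV) Q P \<and> finite Q \<and> tuned R Q"
    if "partition_on (X \<times> UNIV) P" "finite P" for P
    using that by (simp add: tunable_def frame_prod_def R_def)
  obtain x0 where "x0 \<in> X" using e by blast
  then have "(x0, 0) \<in> U" "(x0, 1) \<in> V" by (auto simp: U_def V_def)
  then have "partition_on (X \<times> UNIV) {U, V}"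
    by (auto simp: partition_on_def disjoint_def V_def) (auto simp: U_def)
  then obtain Q where ref: "refines (X \<times> UNIV) Q {U, V}" and fin: "finite Q" and tuned: "tuned R Q"
    using tun by blast
  have ex_block: "\<exists>B\<in>Q. p \<in> B" if "p \<in> X \<times> UNIV" for p
    using ref that unfolding refines_def partition_on_def by blast
  have mono: "B \<subseteq> U \<or> B \<subseteq> V" if "B \<in> Q" for B
    using ref that unfolding refines_def by blast
  have step: "\<exists>q'\<in>C. (p, q') \<in> R"
    if "B \<in> Q" "C \<in> Q" "p \<in> B" "q \<in> B" "r \<in> C" "(q, r) \<in> R" for B C p q r
    using tuned that unfolding tuned_def by blast
  \<comment> \<open>Induction on the smaller count: a double switch in column \<open>y\<close> is
    copied by tunedness into column \<open>x\<close>, which preserves the strict inequality and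
    lowers the count on the left.\<close>
  have no_gap: "\<not> 2 * e x - m < 2 * e y - n"
    if "B \<in> Q" "(x, m) \<in> B" "(y, n) \<in> B" "(x, m) \<in> U" "(y, n) \<in> U" for B x m y n
    using that
  proof (induction "2 * e x - m" arbitrary: m n B rule: less_induct)
    case less
    show ?case
    proof
      assume lt: "2 * e x - m < 2 * e y - n"
      \<comment> \<open>By \<open>lt\<close>, the difference \<open>2 * e y - n\<close> is positive;
        being even, it is at least 2.\<close>
      have y: "y \<in> X" "even n" "n + 2 \<le> 2 * e y"
        using less.prems lt unfolding U_def by (auto, presburger)
      have q1: "(y, n + 1) \<in> V" and q2: "(y, n + 2) \<in> U"
        using y by (auto simp: U_def V_def)
      obtain C D where C: "C \<in> Q" "(y, n + 1) \<in> C" and D: "D \<in> Q" "(y, n + 2) \<in> D"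
        using ex_block y(1) by (metis SigmaI UNIV_I)
      have CV: "C \<subseteq> V" and DU: "D \<subseteq> U"
        using mono[OF C(1)] mono[OF D(1)] C(2) D(2) q1 q2 by (auto simp: V_def)
      have R1: "((y, n), (y, n + 1)) \<in> R" and R2: "((y, n + 1), (y, n + 2)) \<in> R"
        using y(1) by (auto simp: R_def)
      \<comment> \<open>\<open>R\<close> never leaves a column, so the successors found in
        \<open>C\<close> and \<open>D\<close> lie above \<open>(x, m)\<close>.\<close>
      obtain m1 where m1: "(x, m1) \<in> C" "m \<le> m1"
        using step[OF less.prems(1) C(1) less.prems(2,3) C(2) R1] by (auto simp: R_def)
      obtain m2 where m2: "(x, m2) \<in> D" "m1 \<le> m2"
        using step[OF C(1) D(1) m1(1) C(2) D(2) R2] by (auto simp: R_def)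
      have m1V: "(x, m1) \<in> V" and m2U: "(x, m2) \<in> U" using CV DU m1 m2 by auto
      then have "m1 \<noteq> m" "m1 \<noteq> m2" using less.prems(4) by (auto simp: V_def)
      \<comment> \<open>Each change of color forces a strict increase. Together with
        \<open>m2 \<le> 2 * e x\<close> this rules out truncated subtraction, and it is already
        contradictory when \<open>m = 2 * e x\<close>.\<close>
      then have "m + 2 \<le> m2" using m1(2) m2(2) by linarith
      moreover have "m2 \<le> 2 * e x" using m2U by (simp add: U_def)
      ultimately have "2 * e x - m2 < 2 * e x - m" "2 * e x - m2 < 2 * e y - (n + 2)"
        using lt by linarith+
      then show False using less.hyps[OF _ D(1) m2(1) D(2) m2U q2] by blast
    qed
  qed
  define a where "a d = inv_into X e d" for d
  have a: "a d \<in> X" "e (a d) = d" for d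
    using e unfolding a_def by (simp_all add: inv_into_into f_inv_into_f)
  have aU: "(a d, 0) \<in> U" for d using a by (simp add: U_def)
  have "\<forall>d. \<exists>B. B \<in> Q \<and> (a d, 0) \<in> B" using ex_block a by blast
  then obtain blk where blk: "\<And>d. blk d \<in> Q" "\<And>d. (a d, 0) \<in> blk d" by metis
  \<comment> \<open>At height 0 the count is \<open>2 * d\<close>, so \<open>no_gap\<close> in both
    directions recovers \<open>d\<close> from its block.\<close>
  have "inj blk"
  proof (rule injI)
    fix c d assume eq: "blk c = blk d"
    have c: "(a c, 0) \<in> blk c" and d: "(a d, 0) \<in> blk c"
      using blk(2)[of c] blk(2)[of d] by (simp_all only: eq)
    have "\<not> 2 * c < 2 * d" "\<not> 2 * d < 2 * c"
      using no_gap[OF blk(1) c d aU aU] no_gap[OF blk(1) d c aU aU] by (simp_all only: a(2) diff_zero not_False_eq_True)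
    then show "c = d" by linarith
  qed
  then have "infinite (range blk)" using finite_imageD by blast
  moreover have "range blk \<subseteq> Q" using blk(1) by blast
  ultimately show False using fin finite_subset by blast
qed

theorem mainTheorem6:
  shows "(\<exists>(F :: nat frame) (G :: nat frame).
            kripke_frame F \<and> kripke_frame G \<and>
            tunable F \<and> tunable G \<and> \<not> tunable (frame_prod F G)) \<and>
         (\<forall>A :: 'a set. countable A \<and> infinite A \<longrightarrow>
            tunable (A, Id_on A) \<and>
            tunable (UNIV :: nat set, {(m, n). m \<le> n}) \<and>
            \<not> tunable (frame_prod (A, Id_on A) (UNIV :: nat set, {(m, n). m \<le> n})))"
proof (intro conjI allI impI)
  \<comment> \<open>The pure existence claim is the instance where the columns are indexed by the
    natural numbers themselves.\<close>
  have "\<not> tunable (frame_prod (UNIV :: nat set, Id_on UNIV) (UNIV :: nat set, {(m, n). m \<le> n}))"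
    by (rule not_tunable_prod[of id]) simp
  then show "\<exists>(F :: nat frame) (G :: nat frame).
            kripke_frame F \<and> kripke_frame G \<and>
            tunable F \<and> tunable G \<and> \<not> tunable (frame_prod F G)"
    using kripke_frame_UNIV tunable_Id_on tunable_nat_le by blast
next
  fix A :: "'a set" assume A: "countable A \<and> infinite A"
  show "tunable (A, Id_on A)" by (rule tunable_Id_on)
  show "tunable (UNIV :: nat set, {(m, n). m \<le> n})" by (rule tunable_nat_le)
  have "to_nat_on A ` A = UNIV"
    using A to_nat_on_infinite bij_betw_imp_surj_on by blast
  then show "\<not> tunable (frame_prod (A, Id_on A) (UNIV :: nat set, {(m, n). m \<le> n}))"
    by (rule not_tunable_prod)
qed

end
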